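(* Let $n\ge 1$ and let $\alpha,\beta_1,\dots,\beta_n,\gamma\in\widehat{\kappa^\times}$. (i) Suppose that $\alpha\neq\gamma$ and $\beta_i\neq\varepsilon$ for all $i$. Then, for all $\lambda_1,\dots,\lambda_n\in\kappa^\times$, $$-j(\alpha,\overline{\alpha}\gamma)\,F_D^{(n)}\left({\alpha;\beta_1,\dots,\beta_n\atop\gamma};\lambda_1,\dots,\lambda_n\right)=\sum_{u\in\kappa^\times}\Big(\prod_{i=1}^n\overline{\beta_i}(1-\lambda_iu)\Big)\alpha(u)\,\overline{\alpha}\gamma(1-u).$$ (ii) Suppose that $\alpha\neq\varepsilon$ and $\beta_1\cdots\beta_n\neq\gamma$. Then, for all $\lambda_1,\dots,\lambda_n\in\kappa^\times$, $$(-1)^n\frac{\Big(\prod_{i=1}^n g(\beta_i)\Big)g(\overline{\beta_1\cdots\beta_n}\gamma)}{g^\circ(\gamma)}\,F_D^{(n)}\left({\alpha;\beta_1,\dots,\beta_n\atop\gamma};\lambda_1,\dots,\lambda_n\right)$$ $$=\sum_{u_1,\dots,u_n\in\kappa^\times}\overline{\alpha}\Big(1-\sum_{i=1}^n\lambda_iu_i\Big)\Big(\prod_{i=1}^n\beta_i(u_i)\Big)\overline{\beta_1\cdots\beta_n}\gamma\Big(1-\sum_{i=1}^nu_i\Big).$$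
   Context: $\kappa$ is a finite field with $q$ elements of characteristic $p$. $\widehat{\kappa^\times}=\mathrm{Hom}(\kappa^\times,\overline{\mathbb{Q}}^\times)$ is the group of multiplicative characters, $\varepsilon$ the trivial character, $\overline{\eta}=\eta^{-1}$; every $\eta\in\widehat{\kappa^\times}$ (including $\varepsilon$) is extended to $\kappa$ by $\eta(0)=0$. A product of characters followed by an argument means the product character evaluated there. $\delta(\eta)=1$ if $\eta=\varepsilon$ and $0$ otherwise. Fix a non-trivial additive character $\psi\in\mathrm{Hom}(\kappa,\overline{\mathbb{Q}}^\times)$. Put $$g(\eta)=-\sum_{x\in\kappa^\times}\psi(x)\eta(x),\quad g^\circ(\eta)=q^{\delta(\eta)}g(\eta),\quad j(\eta_1,\dots,\eta_k)=(-1)^{k-1}\sum_{x_i\in\kappa^\times,\ x_1+\cdots+x_k=1}\ \prod_{i=1}^k\eta_i(x_i)\ (k\ge 2),$$ $$(\alpha)_\nu=\frac{g(\alpha\nu)}{g(\alpha)},\qquad(\alpha)_\nu^\circ=\frac{g^\circ(\alpha\nu)}{g^\circ(\alpha)}.$$ For $\lambda_i\in\kappa$, $$F_D^{(n)}\left({\alpha;\beta_1,\dots,\beta_n\atop\gamma};\lambda_1,\dots,\lambda_n\right)=\frac{1}{(1-q)^n}\sum_{\nu_1,\dots,\nu_n\in\widehat{\kappa^\times}}\frac{(\alpha)_{\nu_1\cdots\nu_n}(\beta_1)_{\nu_1}\cdots(\beta_n)_{\nu_n}}{(\gamma)^\circ_{\nu_1\cdots\nu_n}(\varepsilon)^\circ_{\nu_1}\cdots(\varepsilon)^\circ_{\nu_n}}\nu_1(\lambda_1)\cdots\nu_n(\lambda_n).$$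 *)

theory Defs
  imports Complex_Main "HOL-Computational_Algebra.Polynomial" "HOL-Library.FuncSet"
    "HOL-Library.Cardinality"
begin

text \<open>
  The finite field is a type \<open>'a :: {field, finite}\<close>, so that \<open>q = CARD('a)\<close>. The algebraic closure
  of the rationals is taken to be the set of algebraic numbers inside \<^typ>\<open>complex\<close>.

  Families indexed by \<open>1, \<dots>, n\<close> are functions on \<^typ>\<open>nat\<close> of which only the values on \<open>{1..n}\<close>
  are used; sums over all such families range over \<open>{1..n} \<rightarrow>\<^sub>E A\<close>, whose members are
  \<open>undefined\<close> outside \<open>{1..n}\<close>, so that each family is counted once.
\<close>

subsection \<open>Multiplicative characters\<close>

text \<open>
  A homomorphism from the units to the nonzero algebraic numbers is represented by its extension
  by \<open>0\<close> to the whole field. This includes the trivial character.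
\<close>

typedef (overloaded) ('a :: "{field, finite}") mult_char =
  "{\<chi> :: 'a \<Rightarrow> complex. \<chi> 0 = 0 \<and> (\<forall>x. x \<noteq> 0 \<longrightarrow> \<chi> x \<noteq> 0 \<and> algebraic (\<chi> x)) \<and>
      (\<forall>x y. x \<noteq> 0 \<longrightarrow> y \<noteq> 0 \<longrightarrow> \<chi> (x * y) = \<chi> x * \<chi> y)}"
  morphisms mchar Abs_mult_char
proof -
  have "algebraic (1 :: complex)" by (rule rat_imp_algebraic) simp
  then show ?thesis by (intro exI[of _ "\<lambda>x. if x = 0 then 0 else 1"]) auto
qed

setup_lifting type_definition_mult_char

lemma units_power_card:
  fixes x :: "'a :: {field, finite}"
  assumes "x \<noteq> 0"
  shows "x ^ card (- {0 :: 'a}) = 1"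
proof -
  have "bij_betw (\<lambda>y. x * y) (- {0}) (- {0})"
    by (rule bij_betw_byWitness[of _ "\<lambda>y. y / x"]) (use assms in auto)
  then have "(\<Prod>y\<in>- {0}. x * y) = (\<Prod>y\<in>- {0}. y)"
    by (rule prod.reindex_bij_betw)
  then show ?thesis
    by (simp add: prod.distrib)
qed

lemma card_units_pos: "card (- {0 :: 'a :: {field, finite}}) > 0"
proof -
  have "1 \<in> - {0 :: 'a}" by simp
  then show ?thesis by (auto simp: card_gt_0_iff simp del: Compl_iff)
qed

lemma root_of_unity_imp_algebraic:
  fixes z :: complex
  assumes "z ^ n = 1" "n > 0"
  shows "algebraic z"
proof (rule algebraicI[of "monom 1 n - 1"])
  show "coeff (monom 1 n - 1) i \<in> \<int>" for i :: nat
    by (simp add: coeff_monom)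
  have "coeff (monom (1 :: complex) n - 1) n = 1"
    using \<open>n > 0\<close> by simp
  then show "monom (1 :: complex) n - 1 \<noteq> 0"
    by (metis coeff_0 zero_neq_one)
  show "poly (monom 1 n - 1) z = 0"
    using assms by (simp add: poly_monom)
qed

lemma multiplicative_imp_root_of_unity:
  fixes \<chi> :: "'a :: {field, finite} \<Rightarrow> complex"
  assumes nz: "\<And>x. x \<noteq> 0 \<Longrightarrow> \<chi> x \<noteq> 0"
    and mult: "\<And>x y. x \<noteq> 0 \<Longrightarrow> y \<noteq> 0 \<Longrightarrow> \<chi> (x * y) = \<chi> x * \<chi> y"
    and "x \<noteq> 0"
  shows "\<chi> x ^ card (- {0 :: 'a}) = 1"
proof -
  have one: "\<chi> 1 = 1"
    using mult[of 1 1] nz[of 1] by simp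
  have "\<chi> (x ^ k) = \<chi> x ^ k" for k
    by (induction k) (use one mult \<open>x \<noteq> 0\<close> in auto)
  then show ?thesis
    using units_power_card[OF \<open>x \<noteq> 0\<close>] one by metis
qed

lemma multiplicative_imp_algebraic:
  fixes \<chi> :: "'a :: {field, finite} \<Rightarrow> complex"
  assumes "\<And>x. x \<noteq> 0 \<Longrightarrow> \<chi> x \<noteq> 0"
    and "\<And>x y. x \<noteq> 0 \<Longrightarrow> y \<noteq> 0 \<Longrightarrow> \<chi> (x * y) = \<chi> x * \<chi> y"
    and "x \<noteq> 0"
  shows "algebraic (\<chi> x)"
  using multiplicative_imp_root_of_unity[of \<chi>, OF assms] card_units_pos
  by (rule root_of_unity_imp_algebraic)

instantiation mult_char :: ("{field, finite}") "{comm_monoid_mult, inverse}"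
begin

lift_definition one_mult_char :: "'a mult_char" is "\<lambda>x. if x = 0 then 0 else 1"
  by (auto intro: rat_imp_algebraic)

lift_definition times_mult_char :: "'a mult_char \<Rightarrow> 'a mult_char \<Rightarrow> 'a mult_char"
  is "\<lambda>\<alpha> \<beta> x. \<alpha> x * \<beta> x"
  subgoal for \<alpha> \<beta>
    using multiplicative_imp_algebraic[of "\<lambda>x. \<alpha> x * \<beta> x"] by simp
  done

lift_definition inverse_mult_char :: "'a mult_char \<Rightarrow> 'a mult_char"
  is "\<lambda>\<alpha> x. inverse (\<alpha> x)"
  subgoal for \<alpha>
    using multiplicative_imp_algebraic[of "\<lambda>x. inverse (\<alpha> x)"] by simp
  done

definition divide_mult_char :: "'a mult_char \<Rightarrow> 'a mult_char \<Rightarrow> 'a mult_char" where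
  "divide_mult_char \<alpha> \<beta> = \<alpha> * inverse \<beta>"

instance
proof
  fix a b c :: "'a mult_char"
  show "a * b * c = a * (b * c)" by transfer (simp add: mult.assoc)
  show "a * b = b * a" by transfer (simp add: mult.commute)
  show "1 * a = a" by transfer auto
qed

end

lemma mult_char_inverse: "\<alpha> * inverse \<alpha> = (1 :: 'a :: {field, finite} mult_char)"
  by transfer auto

instance mult_char :: ("{field, finite}") finite
proof
  let ?N = "card (- {0 :: 'a})"
  let ?R = "insert 0 {z :: complex. z ^ ?N = 1}"
  have "finite ?R"
    using card_units_pos finite_roots_unity[of ?N, where 'a = complex] by (simp add: Suc_le_eq)
  then have fin: "finite (PiE (UNIV :: 'a set) (\<lambda>_. ?R))"
    by (intro finite_PiE) auto
  have "mchar \<chi> \<in> PiE UNIV (\<lambda>_. ?R)" for \<chi> :: "'a mult_char"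
  proof -
    have "mchar \<chi> x \<in> ?R" for x
    proof (cases "x = 0")
      case True
      then show ?thesis using mchar[of \<chi>] by simp
    next
      case False
      then have "mchar \<chi> x ^ ?N = 1"
        using mchar[of \<chi>] by (intro multiplicative_imp_root_of_unity) auto
      then show ?thesis by blast
    qed
    then show ?thesis by (simp only: PiE_UNIV_domain Pi_iff) blast
  qed
  then have "range (mchar :: 'a mult_char \<Rightarrow> _) \<subseteq> PiE UNIV (\<lambda>_. ?R)"
    by blast
  then have "finite (range (mchar :: 'a mult_char \<Rightarrow> _))"
    using fin by (rule finite_subset)
  then show "finite (UNIV :: 'a mult_char set)"
    by (rule finite_imageD) (simp add: inj_on_def mchar_inject)
qed

subsection \<open>Additive characters\<close>

definition additive_char :: "('a :: {field, finite} \<Rightarrow> complex) \<Rightarrow> bool" where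
  "additive_char \<psi> \<longleftrightarrow>
     (\<forall>x. \<psi> x \<noteq> 0 \<and> algebraic (\<psi> x)) \<and> (\<forall>x y. \<psi> (x + y) = \<psi> x * \<psi> y)"

definition nontrivial_additive_char :: "('a :: {field, finite} \<Rightarrow> complex) \<Rightarrow> bool" where
  "nontrivial_additive_char \<psi> \<longleftrightarrow> additive_char \<psi> \<and> (\<exists>x. \<psi> x \<noteq> 1)"

subsection \<open>Gauss and Jacobi sums, and the Lauricella function\<close>

definition delta_char :: "'a :: {field, finite} mult_char \<Rightarrow> nat" where
  "delta_char \<eta> = (if \<eta> = 1 then 1 else 0)"

definition gauss :: "('a :: {field, finite} \<Rightarrow> complex) \<Rightarrow> 'a mult_char \<Rightarrow> complex" where
  "gauss \<psi> \<eta> = - (\<Sum>x\<in>- {0}. \<psi> x * mchar \<eta> x)"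

definition gauss_circ :: "('a :: {field, finite} \<Rightarrow> complex) \<Rightarrow> 'a mult_char \<Rightarrow> complex" where
  "gauss_circ \<psi> \<eta> = of_nat CARD('a) ^ delta_char \<eta> * gauss \<psi> \<eta>"

text \<open>The sum \<open>j(\<eta>\<^sub>1, \<dots>, \<eta>\<^sub>k)\<close>, with the characters given as a list of length \<open>k \<ge> 2\<close>.\<close>

definition jacobi :: "'a :: {field, finite} mult_char list \<Rightarrow> complex" where
  "jacobi \<eta>s = (- 1) ^ (length \<eta>s - 1) *
     (\<Sum>xs | length xs = length \<eta>s \<and> set xs \<subseteq> - {0} \<and> sum_list xs = 1.
        \<Prod>i<length \<eta>s. mchar (\<eta>s ! i) (xs ! i))"

definition poch :: "('a :: {field, finite} \<Rightarrow> complex) \<Rightarrow> 'a mult_char \<Rightarrow> 'a mult_char \<Rightarrow> complex" where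
  "poch \<psi> \<alpha> \<nu> = gauss \<psi> (\<alpha> * \<nu>) / gauss \<psi> \<alpha>"

definition poch_circ :: "('a :: {field, finite} \<Rightarrow> complex) \<Rightarrow> 'a mult_char \<Rightarrow> 'a mult_char \<Rightarrow> complex" where
  "poch_circ \<psi> \<alpha> \<nu> = gauss_circ \<psi> (\<alpha> * \<nu>) / gauss_circ \<psi> \<alpha>"

definition lauricella_FD ::
  "('a :: {field, finite} \<Rightarrow> complex) \<Rightarrow> nat \<Rightarrow> 'a mult_char \<Rightarrow> (nat \<Rightarrow> 'a mult_char) \<Rightarrow>
   'a mult_char \<Rightarrow> (nat \<Rightarrow> 'a) \<Rightarrow> complex" where
  "lauricella_FD \<psi> n \<alpha> \<beta> \<gamma> l =
     1 / (1 - of_nat CARD('a)) ^ n *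
     (\<Sum>\<nu>\<in>{1..n} \<rightarrow>\<^sub>E UNIV.
        (poch \<psi> \<alpha> (\<Prod>i=1..n. \<nu> i) * (\<Prod>i=1..n. poch \<psi> (\<beta> i) (\<nu> i))) /
        (poch_circ \<psi> \<gamma> (\<Prod>i=1..n. \<nu> i) * (\<Prod>i=1..n. poch_circ \<psi> 1 (\<nu> i))) *
        (\<Prod>i=1..n. mchar (\<nu> i) (l i)))"

end

theory Submission
  imports Defs "HOL-Algebra.Algebraic_Closure_Type"
begin

text \<open>
  Write \<open>b\<close> for \<open>inverse \<alpha> * \<gamma>\<close>, \<open>B\<close> for the product of the \<open>\<beta> i\<close>, and \<open>c\<close> for
  \<open>inverse B * \<gamma>\<close>. As over the complex numbers, both integral representations come from expanding
  the part of the integrand that contains the \<open>\<lambda>\<^sub>i\<close> into a power series and integrating term by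
  term; multiplicative characters take the place of monomials, and sums over characters that of
  power series.

  Two finite-field analogues of classical formulas do the work. The first is the binomial theorem
  \<open>multivariate_binomial\<close>: for \<open>\<alpha> \<noteq> 1\<close>, the function \<open>inverse \<alpha> (1 - x\<^sub>1 - \<dots> - x\<^sub>n)\<close> has an
  expansion in the characters \<open>\<nu>\<^sub>1(x\<^sub>1) \<dots> \<nu>\<^sub>n(x\<^sub>n)\<close> whose coefficients are quotients of
  Pochhammer symbols. The second is the Dirichlet integral \<open>dirichlet_integral\<close>: for \<open>c \<noteq> 1\<close>, the
  sum of \<open>a\<^sub>1(u\<^sub>1) \<dots> a\<^sub>n(u\<^sub>n) c(1 - u\<^sub>1 - \<dots> - u\<^sub>n)\<close> is a quotient of Gauss sums.

  For (i), the case \<open>n = 1\<close> of the Dirichlet integral shows that the factor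
  \<open>(\<alpha>)\<^sub>N / (\<gamma>)\<^sup>\<circ>\<^sub>N\<close> of the series (\<open>N\<close> being the product of the \<open>\<nu>\<^sub>i\<close>) times \<open>-j(\<alpha>, b)\<close> is
  the sum of \<open>(\<alpha> N)(u) b(1 - u)\<close> over \<open>u\<close>. Since \<open>N(u)\<close> is the product of the \<open>\<nu>\<^sub>i(u)\<close>,
  the sum over the characters then splits into \<open>n\<close> one-variable binomial series at the points
  \<open>\<lambda>\<^sub>i u\<close>. For (ii), the roles are exchanged: the Dirichlet integral in \<open>n\<close> variables represents
  the factors containing the \<open>\<beta>\<^sub>i\<close> and \<open>\<gamma>\<close>, and what remains is a single binomial series in \<open>n\<close>
  variables, at the points \<open>\<lambda>\<^sub>i u\<^sub>i\<close>.

  Both analogues rest on the orthogonality of characters and on the identity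
  \<open>gauss_twist\<close>: scaling the argument of \<open>\<psi>\<close> by \<open>t\<close> multiplies the Gauss sum of \<open>\<eta>\<close> by
  \<open>inverse \<eta> t\<close>. The hypotheses of the theorem ensure that this identity may also be used
  at \<open>t = 0\<close>, that is, where an argument \<open>1 - \<dots>\<close> vanishes.
\<close>

section \<open>Multiplicative characters and their orthogonality\<close>

lemma mchar_0 [simp]: "mchar \<eta> 0 = 0"
  using mchar[of \<eta>] by simp

lemma mchar_nonzero [simp]: "mchar \<eta> x = 0 \<longleftrightarrow> x = 0"
  using mchar[of \<eta>] by auto

lemma mchar_mult: "mchar \<eta> (x * y) = mchar \<eta> x * mchar \<eta> y"
  using mchar[of \<eta>] by (cases "x = 0 \<or> y = 0") auto

lemma mchar_minus: "mchar \<eta> (- x) = mchar \<eta> (- 1) * mchar \<eta> x"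
  by (simp flip: mchar_mult)

lemma mchar_1 [simp]: "mchar \<eta> 1 = 1"
  using mchar_mult[of \<eta> 1 1] by simp

lemma mchar_inverse_arg: "mchar \<eta> (inverse x) = inverse (mchar \<eta> x)"
proof (cases "x = 0")
  case False
  then have "mchar \<eta> x * mchar \<eta> (inverse x) = 1"
    by (simp flip: mchar_mult)
  then show ?thesis by (metis inverse_unique)
qed simp

lemma mchar_one: "mchar 1 x = (if x = 0 then 0 else 1)"
  by transfer simp

lemma mchar_times: "mchar (\<eta> * \<chi>) x = mchar \<eta> x * mchar \<chi> x"
  by transfer simp

lemma mchar_inverse: "mchar (inverse \<eta>) x = inverse (mchar \<eta> x)"
  by transfer simp

lemma mchar_prod:
  assumes "x \<noteq> 0"
  shows "mchar (\<Prod>i\<in>I. \<eta> i) x = (\<Prod>i\<in>I. mchar (\<eta> i) x)"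
  by (induction I rule: infinite_finite_induct) (simp_all add: assms mchar_one mchar_times)

lemma mchar_minus_1_squared [simp]: "mchar \<eta> (- 1) * mchar \<eta> (- 1) = 1"
  by (simp flip: mchar_mult)

lemma mchar_eqI: "(\<And>x. x \<noteq> 0 \<Longrightarrow> mchar \<eta> x = mchar \<chi> x) \<Longrightarrow> \<eta> = \<chi>"
  by (metis mchar_inject mchar_0 ext)

lemma inverse_inverse_mult_char [simp]:
  "inverse (inverse \<eta>) = (\<eta> :: 'a :: {field, finite} mult_char)"
  by (rule mchar_eqI) (simp add: mchar_inverse)

lemma inverse_one_mult_char [simp]: "inverse 1 = (1 :: 'a :: {field, finite} mult_char)"
  by (rule mchar_eqI) (simp add: mchar_inverse mchar_one)

lemma inverse_mult_char_eq_1_iff [simp]: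
  "inverse \<eta> = 1 \<longleftrightarrow> \<eta> = (1 :: 'a :: {field, finite} mult_char)"
  by (metis inverse_inverse_mult_char inverse_one_mult_char)

lemma mult_char_mult_inverse_cancel [simp]:
  "\<eta> * (inverse \<eta> * \<chi>) = (\<chi> :: 'a :: {field, finite} mult_char)"
  "inverse \<eta> * (\<eta> * \<chi>) = \<chi>"
  by (rule mchar_eqI; simp add: mchar_times mchar_inverse)+

lemma inverse_mult_char_mult_eq_1_iff:
  "inverse \<eta> * \<chi> = 1 \<longleftrightarrow> \<chi> = (\<eta> :: 'a :: {field, finite} mult_char)"
proof
  assume "inverse \<eta> * \<chi> = 1"
  then have "\<eta> * (inverse \<eta> * \<chi>) = \<eta>" by simp
  then show "\<chi> = \<eta>" by simp
qed (simp add: mult_char_inverse mult.commute)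

text \<open>
  The cyclicity of the multiplicative group of a finite field, carried over from the locale-based
  setting of fields with a carrier to the type class.
\<close>

lemma units_cyclic:
  obtains g :: "'a :: {field, finite}"
  where "g \<noteq> 0" and "\<And>x. x \<noteq> 0 \<Longrightarrow> \<exists>k. x = g ^ k"
proof -
  define K where "K = (ring_of_type_algebra :: 'a ring)"
  interpret K: field K unfolding K_def by (rule field_from_type_algebra)
  have carrier: "carrier (mult_of K) = - {0}"
    by (auto simp: K_def ring_of_type_algebra_def)
  have pow: "a [^]\<^bsub>K\<^esub> k = a ^ k" for a and k :: nat
    by (induction k) (simp_all add: K_def ring_of_type_algebra_def)
  have "finite (carrier K)" by (simp add: K_def ring_of_type_algebra_def)
  from K.finite_field_mult_group_has_gen[OF this] obtain g
    where g: "g \<in> carrier (mult_of K)" "carrier (mult_of K) = {g [^]\<^bsub>K\<^esub> k | k :: nat. k \<in> UNIV}"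
    by auto
  show thesis
  proof
    show "g \<noteq> 0" using g(1) carrier by auto
    show "\<exists>k. x = g ^ k" if "x \<noteq> 0" for x
      using that g(2) carrier pow by auto
  qed
qed

text \<open>
  A character is obtained by sending a generator \<open>g\<close> of the unit group, whose order is the number
  \<open>N\<close> of units, to a primitive \<open>N\<close>-th root of unity \<open>\<zeta>\<close>. It is injective, hence differs from
  \<open>1\<close> at every \<open>x \<noteq> 1\<close>.
\<close>

lemma mult_char_separates:
  fixes x :: "'a :: {field, finite}"
  assumes "x \<noteq> 0" "x \<noteq> 1"
  obtains \<eta> :: "'a mult_char" where "mchar \<eta> x \<noteq> 1"
proof -
  obtain g :: 'a where g: "g \<noteq> 0" "\<And>x. x \<noteq> 0 \<Longrightarrow> \<exists>k. x = g ^ k"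
    using units_cyclic by blast
  define N where "N = card (- {0 :: 'a})"
  have N: "N > 0" unfolding N_def by (rule card_units_pos)
  have gN: "g ^ N = 1" using units_power_card[OF g(1)] by (simp add: N_def)
  have pow_mod: "g ^ k = g ^ (k mod N)" for k
    by (metis gN div_mult_mod_eq power_add power_mult power_one mult.commute mult_1)
  have img: "(\<lambda>k. g ^ k) ` {..<N} = - {0}"
  proof
    show "(\<lambda>k. g ^ k) ` {..<N} \<subseteq> - {0}" using g(1) by auto
    show "- {0} \<subseteq> (\<lambda>k. g ^ k) ` {..<N}"
    proof
      fix y :: 'a assume "y \<in> - {0}"
      then obtain k where "y = g ^ k" using g(2) by auto
      then show "y \<in> (\<lambda>k. g ^ k) ` {..<N}"
        using pow_mod[of k] N by auto
    qed
  qed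
  then have inj: "inj_on (\<lambda>k. g ^ k) {..<N}"
    by (intro eq_card_imp_inj_on) (simp_all add: N_def)
  have eq_mod: "i mod N = j mod N" if "g ^ i = g ^ j" for i j
    using inj_onD[OF inj, of "i mod N" "j mod N"] that N by (simp flip: pow_mod)
  \<comment> \<open>The discrete logarithm is determined modulo \<open>N\<close> only, which suffices as \<open>\<zeta> ^ N = 1\<close>.\<close>
  define lg where "lg y = (SOME k. y = g ^ k)" for y
  have lg: "g ^ lg y = y" if "y \<noteq> 0" for y
    using someI_ex[OF g(2)[OF that]] by (simp add: lg_def)
  define \<zeta> where "\<zeta> = cis (2 * pi / N)"
  have \<zeta>N: "\<zeta> ^ N = 1" using N by (simp add: \<zeta>_def DeMoivre)
  have \<zeta>_mod: "\<zeta> ^ k = \<zeta> ^ (k mod N)" for k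
    by (metis \<zeta>N div_mult_mod_eq power_add power_mult power_one mult.commute mult_1)
  define f where "f y = (if y = 0 then 0 else \<zeta> ^ lg y)" for y
  have \<zeta>0: "\<zeta> \<noteq> 0" by (simp add: \<zeta>_def)
  have fmult: "f (y * z) = f y * f z" if "y \<noteq> 0" "z \<noteq> 0" for y z
  proof -
    have "g ^ lg (y * z) = g ^ (lg y + lg z)"
      using that by (simp add: lg power_add)
    then have "\<zeta> ^ lg (y * z) = \<zeta> ^ (lg y + lg z)"
      using eq_mod \<zeta>_mod by metis
    then show ?thesis using that by (simp add: f_def power_add)
  qed
  have fnz: "f y \<noteq> 0" if "y \<noteq> 0" for y
    using that \<zeta>0 by (simp add: f_def)
  have f: "mchar (Abs_mult_char f) = f"
    using multiplicative_imp_algebraic[of f, OF fnz fmult] fnz fmult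
    by (intro Abs_mult_char_inverse) (auto simp: f_def)
  have "f x \<noteq> 1"
  proof
    assume "f x = 1"
    then have "\<zeta> ^ (lg x mod N) = 1"
      using assms(1) \<zeta>_mod by (simp add: f_def)
    moreover have "inj_on (\<lambda>k. cis (2 * pi * real k / real N)) {..<N}"
      using bij_betw_roots_unity[OF N] by (simp add: bij_betw_def)
    ultimately have "lg x mod N = 0"
      using N by (auto simp: \<zeta>_def DeMoivre mult_ac dest: inj_onD[of _ _ "lg x mod N" 0])
    then have "g ^ lg x = 1" using pow_mod[of "lg x"] by simp
    then show False using lg assms by simp
  qed
  then show thesis using f that by metis
qed

lemma card_units_eq: "of_nat (card (- {0 :: 'a :: {field, finite}})) = (of_nat CARD('a) - 1 :: complex)"
proof -
  have "card (- {0 :: 'a}) + 1 = CARD('a)"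
    using card_Suc_Diff1[of UNIV "0 :: 'a"] by (simp add: Compl_eq_Diff_UNIV)
  then have "of_nat (card (- {0 :: 'a}) + 1) = (of_nat CARD('a) :: complex)" by simp
  then show ?thesis by (simp add: eq_diff_eq add.commute)
qed

lemma CARD_field_neq_1 [simp]: "CARD('a :: {field, finite}) \<noteq> Suc 0"
proof
  assume "CARD('a) = Suc 0"
  then have "card (- {0 :: 'a}) = 0"
    using card_units_eq[where 'a = 'a] by simp
  then show False using card_units_pos[where 'a = 'a] by linarith
qed

lemma bij_betw_times_unit:
  fixes c :: "'a :: field"
  assumes "c \<noteq> 0"
  shows "bij_betw (\<lambda>x. c * x) (- {0}) (- {0})"
  by (rule bij_betw_byWitness[of _ "\<lambda>y. y / c"]) (use assms in auto)

lemma sum_mchar: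
  fixes \<eta> :: "'a :: {field, finite} mult_char"
  shows "(\<Sum>x\<in>- {0}. mchar \<eta> x) = (if \<eta> = 1 then of_nat CARD('a) - 1 else 0)"
proof (cases "\<eta> = 1")
  case True
  then show ?thesis by (simp add: mchar_one card_units_eq)
next
  case False
  then obtain c where c: "c \<noteq> 0" "mchar \<eta> c \<noteq> 1"
    using mchar_eqI[of \<eta> 1] by (auto simp: mchar_one)
  have "(\<Sum>x\<in>- {0}. mchar \<eta> x) = (\<Sum>x\<in>- {0}. mchar \<eta> (c * x))"
    by (rule sum.reindex_bij_betw[symmetric]) (rule bij_betw_times_unit[OF c(1)])
  also have "\<dots> = mchar \<eta> c * (\<Sum>x\<in>- {0}. mchar \<eta> x)"
    by (simp add: mchar_mult sum_distrib_left)
  finally show ?thesis using c False by simp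
qed

text \<open>
  That the sum vanishes at \<open>x \<noteq> 1\<close> uses a character with value different from \<open>1\<close> at \<open>x\<close>. The
  value at \<open>x = 1\<close> is the number of characters, which equals the number of units by comparing
  the two orders of summation over pairs of a unit and a character.
\<close>

lemma sum_mult_char:
  fixes x :: "'a :: {field, finite}"
  assumes "x \<noteq> 0"
  shows "(\<Sum>\<eta>\<in>UNIV. mchar \<eta> x) = (if x = 1 then of_nat CARD('a) - 1 else 0)"
proof -
  have off: "(\<Sum>\<eta>\<in>UNIV. mchar \<eta> y) = 0" if "y \<noteq> 0" "y \<noteq> 1" for y :: 'a
  proof -
    obtain \<chi> where \<chi>: "mchar \<chi> y \<noteq> 1" using mult_char_separates \<open>y \<noteq> 0\<close> \<open>y \<noteq> 1\<close> by metis
    have "bij (\<lambda>\<eta>. \<chi> * \<eta>)"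
      by (rule bij_betw_byWitness[of _ "\<lambda>\<eta>. inverse \<chi> * \<eta>"]) auto
    then have "(\<Sum>\<eta>\<in>UNIV. mchar \<eta> y) = (\<Sum>\<eta>\<in>UNIV. mchar (\<chi> * \<eta>) y)"
      by (rule sum.reindex_bij_betw[symmetric])
    also have "\<dots> = mchar \<chi> y * (\<Sum>\<eta>\<in>UNIV. mchar \<eta> y)"
      by (simp add: mchar_times sum_distrib_left)
    finally show ?thesis using \<chi> by simp
  qed
  have "(\<Sum>\<eta>\<in>UNIV. mchar \<eta> (1 :: 'a)) = (\<Sum>y\<in>- {0 :: 'a}. \<Sum>\<eta>\<in>UNIV. mchar \<eta> y)"
    by (subst sum.mono_neutral_right[of "- {0 :: 'a}" "{1}"]) (use off in auto)
  also have "\<dots> = (\<Sum>\<eta>\<in>(UNIV :: 'a mult_char set). \<Sum>y\<in>- {0}. mchar \<eta> y)"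
    by (rule sum.swap)
  also have "\<dots> = of_nat CARD('a) - 1"
    by (simp add: sum_mchar)
  finally show ?thesis using off assms by auto
qed

section \<open>Gauss sums\<close>

lemma additive_char_0: "additive_char \<psi> \<Longrightarrow> \<psi> 0 = 1"
  unfolding additive_char_def by (metis add_0 mult_cancel_left1)

lemma additive_char_add: "additive_char \<psi> \<Longrightarrow> \<psi> (x + y) = \<psi> x * \<psi> y"
  by (simp add: additive_char_def)

lemma additive_char_sum:
  assumes "additive_char \<psi>"
  shows "\<psi> (\<Sum>i\<in>I. x i) = (\<Prod>i\<in>I. \<psi> (x i))"
  by (induction I rule: infinite_finite_induct)
    (simp_all add: assms additive_char_0 additive_char_add)

context
  fixes \<psi> :: "'a :: {field, finite} \<Rightarrow> complex"
  assumes nontrivial: "nontrivial_additive_char \<psi>"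
begin

lemma psi: "additive_char \<psi>"
  using nontrivial by (simp add: nontrivial_additive_char_def)

lemma sum_additive_char_units:
  "(\<Sum>x\<in>- {0}. \<psi> (x * c)) = (if c = 0 then of_nat CARD('a) - 1 else - 1)"
proof (cases "c = 0")
  case True
  then show ?thesis using psi by (simp add: additive_char_0 card_units_eq)
next
  case False
  obtain a where a: "\<psi> a \<noteq> 1"
    using nontrivial by (auto simp: nontrivial_additive_char_def)
  have "(\<Sum>x\<in>UNIV. \<psi> x) = (\<Sum>x\<in>UNIV. \<psi> (a + x))"
    by (rule sum.reindex_bij_betw[symmetric])
      (rule bij_betw_byWitness[of _ "\<lambda>y. y - a"]; auto)
  also have "\<dots> = \<psi> a * (\<Sum>x\<in>UNIV. \<psi> x)"
    by (simp add: additive_char_add psi sum_distrib_left)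
  finally have "(\<Sum>x\<in>UNIV. \<psi> x) = 0" using a by simp
  then have "(\<Sum>x\<in>- {0}. \<psi> x) = - 1"
    using psi by (simp add: Compl_eq_Diff_UNIV sum_diff1 additive_char_0)
  then show ?thesis
    using sum.reindex_bij_betw[OF bij_betw_times_unit[OF False], of \<psi>] False
    by (simp add: mult.commute)
qed

lemma gauss_one: "gauss \<psi> 1 = 1"
  using sum_additive_char_units[of 1] by (simp add: gauss_def mchar_one)

text \<open>
  For \<open>t \<noteq> 0\<close> this is the substitution of \<open>t * y\<close> for \<open>y\<close>. At \<open>t = 0\<close> both sides vanish if
  \<open>\<eta> \<noteq> 1\<close>, the left one by orthogonality and the right one by the convention
  \<open>mchar \<eta> 0 = 0\<close>; if \<open>\<eta> = 1\<close>, the left side is the number of units instead.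
\<close>

lemma gauss_twist:
  assumes "t \<noteq> 0 \<or> \<eta> \<noteq> 1"
  shows "(\<Sum>y\<in>- {0}. \<psi> (t * y) * mchar \<eta> y) = - gauss \<psi> \<eta> * mchar (inverse \<eta>) t"
proof (cases "t = 0")
  case True
  then show ?thesis using assms psi by (simp add: additive_char_0 sum_mchar)
next
  case False
  have "(\<Sum>y\<in>- {0}. \<psi> y * mchar \<eta> y) = (\<Sum>y\<in>- {0}. \<psi> (t * y) * mchar \<eta> (t * y))"
    by (rule sum.reindex_bij_betw[symmetric]) (rule bij_betw_times_unit[OF False])
  also have "\<dots> = mchar \<eta> t * (\<Sum>y\<in>- {0}. \<psi> (t * y) * mchar \<eta> y)"
    by (simp add: mchar_mult sum_distrib_left mult_ac)
  finally show ?thesis using False by (simp add: gauss_def mchar_inverse field_simps)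
qed

text \<open>
  The analogue of Euler's reflection formula for the Gamma function. The factor by which
  \<^const>\<open>gauss_circ\<close> differs from \<^const>\<open>gauss\<close> makes it hold for the trivial character as well.
  In the other case, expanding one Gauss sum and absorbing the other one by \<open>gauss_twist\<close> leaves a
  sum of \<open>\<psi> (t * (1 + y))\<close> over \<open>t\<close>, which singles out \<open>y = - 1\<close>.
\<close>

lemma gauss_reflection:
  "gauss \<psi> \<eta> * gauss_circ \<psi> (inverse \<eta>) = of_nat CARD('a) * mchar \<eta> (- 1)"
proof (cases "\<eta> = 1")
  case True
  then show ?thesis by (simp add: gauss_circ_def delta_char_def gauss_one mchar_one)
next
  case False
  have "gauss \<psi> \<eta> * gauss \<psi> (inverse \<eta>)
      = (\<Sum>t\<in>- {0}. \<psi> t * (- gauss \<psi> \<eta> * mchar (inverse \<eta>) t))"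
    unfolding gauss_def[of _ "inverse \<eta>"] by (simp add: sum_distrib_left mult_ac sum_negf)
  also have "\<dots> = (\<Sum>t\<in>- {0}. \<psi> t * (\<Sum>y\<in>- {0}. \<psi> (t * y) * mchar \<eta> y))"
    using False by (simp add: gauss_twist)
  also have "\<dots> = (\<Sum>y\<in>- {0}. mchar \<eta> y * (\<Sum>t\<in>- {0}. \<psi> (t * (1 + y))))"
    unfolding sum_distrib_left
    by (subst sum.swap) (simp add: additive_char_add[OF psi] distrib_left mult_ac)
  also have "\<dots> = (\<Sum>y\<in>- {0}. (if y = - 1 then of_nat CARD('a) * mchar \<eta> (- 1) else 0) - mchar \<eta> y)"
    by (intro sum.cong refl) (auto simp: sum_additive_char_units add_eq_0_iff right_diff_distrib)
  also have "\<dots> = of_nat CARD('a) * mchar \<eta> (- 1)"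
    using False by (simp add: sum_subtractf sum_mchar)
  finally show ?thesis using False by (simp add: gauss_circ_def delta_char_def)
qed

lemma gauss_nonzero [simp]: "gauss \<psi> \<eta> \<noteq> 0"
  using gauss_reflection[of \<eta>] by auto

lemma gauss_circ_nonzero [simp]: "gauss_circ \<psi> \<eta> \<noteq> 0"
  by (simp add: gauss_circ_def)

text \<open>
  The symbols \<open>poch_circ \<psi> 1 \<nu>\<close> play the part of the factorials in the denominators of a
  hypergeometric series; the reflection formula moves them to the numerator.
\<close>

lemma poch_circ_one: "1 / poch_circ \<psi> 1 \<nu> = mchar \<nu> (- 1) * gauss \<psi> (inverse \<nu>)"
proof -
  have "gauss \<psi> (inverse \<nu>) * gauss_circ \<psi> \<nu> = of_nat CARD('a) * inverse (mchar \<nu> (- 1))"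
    using gauss_reflection[of "inverse \<nu>"] by (simp add: mchar_inverse)
  then show ?thesis
    by (simp add: poch_circ_def gauss_circ_def[of _ 1] delta_char_def gauss_one field_simps)
qed

text \<open>
  Fourier inversion on the group of units: Gauss sums are the Fourier coefficients of \<open>\<psi>\<close>. This is
  the analogue of the exponential series, the coefficients being reciprocals of
  \<open>poch_circ \<psi> 1 \<nu>\<close> up to the factor \<open>mchar \<nu> (- 1)\<close>.
\<close>

lemma sum_gauss_mult_char:
  assumes "t \<noteq> 0"
  shows "(\<Sum>\<nu>\<in>UNIV. gauss \<psi> (inverse \<nu>) * mchar \<nu> t) = (1 - of_nat CARD('a)) * \<psi> t"
proof -
  have "(\<Sum>\<nu>\<in>UNIV. gauss \<psi> (inverse \<nu>) * mchar \<nu> t)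
      = - (\<Sum>\<nu>\<in>UNIV. \<Sum>x\<in>- {0}. \<psi> x * mchar \<nu> (t * inverse x))"
    by (simp add: gauss_def mchar_mult mchar_inverse mchar_inverse_arg sum_distrib_left
        sum_distrib_right sum_negf mult_ac)
  also have "\<dots> = - (\<Sum>x\<in>- {0}. \<psi> x * (\<Sum>\<nu>\<in>UNIV. mchar \<nu> (t * inverse x)))"
    by (subst sum.swap) (simp add: sum_distrib_left)
  also have "\<dots> = - (\<Sum>x\<in>- {0}. if x = t then (of_nat CARD('a) - 1) * \<psi> t else 0)"
    using assms by (intro arg_cong[of _ _ uminus] sum.cong refl)
      (auto simp: sum_mult_char field_simps)
  also have "\<dots> = (1 - of_nat CARD('a)) * \<psi> t"
    using assms by (simp add: algebra_simps)
  finally show ?thesis .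
qed

section \<open>The binomial theorem and the Dirichlet integral\<close>

text \<open>
  As one proves the binomial series from the Gamma integral, expand the Gauss sum of \<open>\<alpha>\<close> times the
  product of the \<open>\<nu> i\<close> as a sum over \<open>y\<close>. The sum over the characters then factors into exponential series, which produce
  \<open>\<psi> (- x i * y)\<close>; together with the factor \<open>\<psi> y\<close>, the remaining sum over \<open>y\<close> is the Gauss
  sum of \<open>\<alpha>\<close> scaled by \<open>1 - (\<Sum>i\<in>I. x i)\<close>, which may be \<open>0\<close>: hence \<open>\<alpha> \<noteq> 1\<close>.
\<close>

lemma multivariate_binomial:
  assumes "finite I" "\<alpha> \<noteq> 1" and x: "\<And>i. i \<in> I \<Longrightarrow> x i \<noteq> 0"
  shows "(\<Sum>\<nu>\<in>I \<rightarrow>\<^sub>E UNIV. poch \<psi> \<alpha> (\<Prod>i\<in>I. \<nu> i) / (\<Prod>i\<in>I. poch_circ \<psi> 1 (\<nu> i)) *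
      (\<Prod>i\<in>I. mchar (\<nu> i) (x i))) =
    (1 - of_nat CARD('a)) ^ card I * mchar (inverse \<alpha>) (1 - (\<Sum>i\<in>I. x i))"
proof -
  have summand: "poch \<psi> \<alpha> (\<Prod>i\<in>I. \<nu> i) / (\<Prod>i\<in>I. poch_circ \<psi> 1 (\<nu> i)) *
      (\<Prod>i\<in>I. mchar (\<nu> i) (x i)) = - 1 / gauss \<psi> \<alpha> *
      (\<Sum>y\<in>- {0}. \<psi> y * mchar \<alpha> y * (\<Prod>i\<in>I. gauss \<psi> (inverse (\<nu> i)) * mchar (\<nu> i) (- x i * y)))"
    (is "?l = ?r") for \<nu>
  proof -
    have "1 / (\<Prod>i\<in>I. poch_circ \<psi> 1 (\<nu> i)) * (\<Prod>i\<in>I. mchar (\<nu> i) (x i))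
        = (\<Prod>i\<in>I. 1 / poch_circ \<psi> 1 (\<nu> i) * mchar (\<nu> i) (x i))"
      by (simp add: prod_dividef)
    also have "\<dots> = (\<Prod>i\<in>I. gauss \<psi> (inverse (\<nu> i)) * mchar (\<nu> i) (- x i))"
      unfolding poch_circ_one by (simp add: mchar_minus[of _ "x _"] mult_ac)
    finally have expand: "?l = poch \<psi> \<alpha> (\<Prod>i\<in>I. \<nu> i) *
        (\<Prod>i\<in>I. gauss \<psi> (inverse (\<nu> i)) * mchar (\<nu> i) (- x i))"
      by (simp flip: times_divide_eq_right)
    then have *: "?l = - 1 / gauss \<psi> \<alpha> * (\<Sum>y\<in>- {0}. \<psi> y * mchar (\<alpha> * (\<Prod>i\<in>I. \<nu> i)) y *
        (\<Prod>i\<in>I. gauss \<psi> (inverse (\<nu> i)) * mchar (\<nu> i) (- x i)))"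
      by (simp add: poch_def gauss_def[of _ "\<alpha> * _"] flip: sum_distrib_right)
    show ?thesis unfolding *
      by (intro arg_cong[of _ _ "(*) _"] sum.cong refl)
        (simp add: mchar_times mchar_prod prod.distrib mult_ac mchar_mult
          del: mult_minus_left mult_minus_right)
  qed
  have "(\<Sum>\<nu>\<in>I \<rightarrow>\<^sub>E UNIV. poch \<psi> \<alpha> (\<Prod>i\<in>I. \<nu> i) / (\<Prod>i\<in>I. poch_circ \<psi> 1 (\<nu> i)) *
      (\<Prod>i\<in>I. mchar (\<nu> i) (x i))) = - 1 / gauss \<psi> \<alpha> * (\<Sum>y\<in>- {0}. \<psi> y * mchar \<alpha> y *
      (\<Sum>\<nu>\<in>I \<rightarrow>\<^sub>E UNIV. \<Prod>i\<in>I. gauss \<psi> (inverse (\<nu> i)) * mchar (\<nu> i) (- x i * y)))"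
    unfolding summand by (simp only: sum_distrib_left sum.swap[of _ "- {0}"])
  also have "\<dots> = - 1 / gauss \<psi> \<alpha> * (\<Sum>y\<in>- {0}. \<psi> y * mchar \<alpha> y *
      (\<Prod>i\<in>I. (1 - of_nat CARD('a)) * \<psi> (- x i * y)))"
  proof (intro arg_cong[of _ _ "(*) _"] sum.cong refl)
    fix y :: 'a assume "y \<in> - {0}"
    then show "(\<Sum>\<nu>\<in>I \<rightarrow>\<^sub>E UNIV. \<Prod>i\<in>I. gauss \<psi> (inverse (\<nu> i)) * mchar (\<nu> i) (- x i * y))
      = (\<Prod>i\<in>I. (1 - of_nat CARD('a)) * \<psi> (- x i * y))"
      using x assms(1)
      by (subst prod_sum_PiE[symmetric]) (auto intro!: prod.cong sum_gauss_mult_char)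
  qed
  also have "\<dots> = - 1 / gauss \<psi> \<alpha> * (1 - of_nat CARD('a)) ^ card I *
      (\<Sum>y\<in>- {0}. \<psi> ((1 - (\<Sum>i\<in>I. x i)) * y) * mchar \<alpha> y)"
  proof -
    have "\<psi> ((1 - (\<Sum>i\<in>I. x i)) * y) = \<psi> y * (\<Prod>i\<in>I. \<psi> (- x i * y))" for y
      by (simp add: algebra_simps sum_distrib_left sum_negf
          flip: additive_char_sum[OF psi] additive_char_add[OF psi])
    then show ?thesis
      by (simp add: prod.distrib sum_distrib_left mult_ac)
  qed
  finally show ?thesis using assms(2) by (simp add: gauss_twist)
qed

text \<open>
  The last factor of the summand couples the variables. Writing it as a Gauss sum in a new variable
  \<open>y\<close> replaces it by an additive character of \<open>u\<close>, so that the sums over the \<open>u i\<close> separate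
  and are scaled Gauss sums of the \<open>a i\<close>. Summing over \<open>y\<close> yields the Gauss sum of the inverse of
  \<open>(\<Prod>i\<in>I. a i) * c\<close>, which reflection moves to the denominator.
\<close>

lemma dirichlet_integral:
  assumes "finite I" "c \<noteq> 1"
  shows "(\<Sum>u\<in>I \<rightarrow>\<^sub>E - {0}. (\<Prod>i\<in>I. mchar (a i) (u i)) * mchar c (1 - (\<Sum>i\<in>I. u i))) =
    (- 1) ^ card I * (\<Prod>i\<in>I. gauss \<psi> (a i)) * gauss \<psi> c / gauss_circ \<psi> ((\<Prod>i\<in>I. a i) * c)"
proof -
  define A where "A = (\<Prod>i\<in>I. a i)"
  define g where "g = gauss \<psi> (inverse c)"
  have g0: "g \<noteq> 0" by (simp add: g_def)
  \<comment> \<open>This is valid also at \<open>t = 0\<close>, because \<open>c \<noteq> 1\<close>.\<close>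
  have c: "mchar c t = - (1 / g) * (\<Sum>y\<in>- {0}. \<psi> (t * y) * mchar (inverse c) y)" for t
    using gauss_twist[of t "inverse c"] assms(2) g0 by (simp add: g_def)
  have split: "\<psi> ((1 - (\<Sum>i\<in>I. u i)) * y) = \<psi> y * (\<Prod>i\<in>I. \<psi> (- y * u i))" for u y
    by (simp add: algebra_simps sum_distrib_left sum_negf
        flip: additive_char_sum[OF psi] additive_char_add[OF psi])
  have "(\<Sum>u\<in>I \<rightarrow>\<^sub>E - {0}. (\<Prod>i\<in>I. mchar (a i) (u i)) * mchar c (1 - (\<Sum>i\<in>I. u i))) =
    (\<Sum>u\<in>I \<rightarrow>\<^sub>E - {0}. \<Sum>y\<in>- {0}. - (1 / g) * (\<psi> y * mchar (inverse c) y *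
      (\<Prod>i\<in>I. \<psi> (- y * u i) * mchar (a i) (u i))))"
    unfolding c split by (simp add: sum_distrib_left prod.distrib mult_ac)
  also have "\<dots> = - (1 / g) * (\<Sum>y\<in>- {0}. \<psi> y * mchar (inverse c) y *
      (\<Sum>u\<in>I \<rightarrow>\<^sub>E - {0}. \<Prod>i\<in>I. \<psi> (- y * u i) * mchar (a i) (u i)))"
    by (subst sum.swap) (simp only: sum_distrib_left)
  also have "\<dots> = - (1 / g) * (\<Sum>y\<in>- {0}. \<psi> y * mchar (inverse c) y *
      (\<Prod>i\<in>I. - gauss \<psi> (a i) * mchar (inverse (a i)) (- y)))"
  proof (intro arg_cong[of _ _ "(*) _"] sum.cong refl)
    fix y :: 'a assume "y \<in> - {0}"
    then show "(\<Sum>u\<in>I \<rightarrow>\<^sub>E - {0}. \<Prod>i\<in>I. \<psi> (- y * u i) * mchar (a i) (u i))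
      = (\<Prod>i\<in>I. - gauss \<psi> (a i) * mchar (inverse (a i)) (- y))"
      using assms(1)
      by (subst prod_sum_PiE[symmetric]) (auto intro!: prod.cong gauss_twist simp del: mult_minus_left)
  qed
  also have "\<dots> = - (1 / g) * (\<Sum>y\<in>- {0}. (- 1) ^ card I * (\<Prod>i\<in>I. gauss \<psi> (a i)) * mchar A (- 1) *
      (\<psi> y * mchar (inverse (A * c)) y))"
  proof (intro arg_cong[of _ _ "(*) _"] sum.cong refl)
    fix y :: 'a assume y: "y \<in> - {0}"
    have "(\<Prod>i\<in>I. - gauss \<psi> (a i) * mchar (inverse (a i)) (- y)) =
        (- 1) ^ card I * (\<Prod>i\<in>I. gauss \<psi> (a i)) * inverse (mchar A (- y))"
      using y prod_inversef[of "\<lambda>i. mchar (a i) (- y)" I]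
      by (simp add: A_def prod.distrib mchar_prod mchar_inverse prod_uminus comp_def)
    also have "mchar A (- y) = mchar A (- 1) * mchar A y"
      by (rule mchar_minus)
    finally show "\<psi> y * mchar (inverse c) y * (\<Prod>i\<in>I. - gauss \<psi> (a i) * mchar (inverse (a i)) (- y))
      = (- 1) ^ card I * (\<Prod>i\<in>I. gauss \<psi> (a i)) * mchar A (- 1) * (\<psi> y * mchar (inverse (A * c)) y)"
      using inverse_unique[OF mchar_minus_1_squared[of A]]
      by (simp add: mchar_inverse mchar_times)
  qed
  also have "\<dots> = (- 1) ^ card I * (\<Prod>i\<in>I. gauss \<psi> (a i)) * (mchar A (- 1) * gauss \<psi> (inverse (A * c)) / g)"
    unfolding gauss_def[of _ "inverse (A * c)"] by (simp flip: sum_distrib_left)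
  also have "mchar A (- 1) * gauss \<psi> (inverse (A * c)) / g = gauss \<psi> c / gauss_circ \<psi> (A * c)"
  proof -
    have "gauss \<psi> (inverse (A * c)) * gauss_circ \<psi> (A * c) = of_nat CARD('a) * (mchar A (- 1) * mchar c (- 1))"
      using gauss_reflection[of "inverse (A * c)"]
        inverse_unique[OF mchar_minus_1_squared[of "A * c"]]
      by (simp add: mchar_inverse mchar_times)
    then have "mchar A (- 1) * (gauss \<psi> (inverse (A * c)) * gauss_circ \<psi> (A * c))
        = (mchar A (- 1) * mchar A (- 1)) * (of_nat CARD('a) * mchar c (- 1))"
      by (simp only: mult_ac)
    also have "\<dots> = gauss \<psi> c * g"
      using gauss_reflection[of c] assms(2) by (simp add: g_def gauss_circ_def delta_char_def)
    finally show ?thesis using g0 by (simp add: field_simps)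
  qed
  finally show ?thesis by (simp add: A_def)
qed

lemma sum_PiE_singleton:
  assumes "finite A"
  shows "(\<Sum>f\<in>{k} \<rightarrow>\<^sub>E A. h (f k)) = (\<Sum>x\<in>A. h x :: complex)"
  using prod_sum_PiE[of "{k}" "\<lambda>_. A" "\<lambda>_. h"] assms by simp

lemma univariate_binomial:
  assumes "\<beta> \<noteq> 1" "x \<noteq> 0"
  shows "(\<Sum>\<nu>\<in>UNIV. poch \<psi> \<beta> \<nu> / poch_circ \<psi> 1 \<nu> * mchar \<nu> x) =
    (1 - of_nat CARD('a)) * mchar (inverse \<beta>) (1 - x)"
  using multivariate_binomial[of "{0 :: nat}" \<beta> "\<lambda>_. x"] assms
    sum_PiE_singleton[of UNIV "\<lambda>\<nu>. poch \<psi> \<beta> \<nu> / poch_circ \<psi> 1 \<nu> * mchar \<nu> x" "0 :: nat"]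
  by simp

lemma beta_integral:
  assumes "b \<noteq> 1"
  shows "(\<Sum>u\<in>- {0}. mchar a u * mchar b (1 - u)) = - (gauss \<psi> a * gauss \<psi> b / gauss_circ \<psi> (a * b))"
  using dirichlet_integral[of "{0 :: nat}" b "\<lambda>_. a"] assms
    sum_PiE_singleton[of "- {0}" "\<lambda>u. mchar a u * mchar b (1 - u)" "0 :: nat"]
  by simp

end

text \<open>
  Allowing \<open>u = 1\<close> on the right is harmless, since \<open>mchar b 0 = 0\<close>.
\<close>

lemma jacobi_two:
  fixes a b :: "'a :: {field, finite} mult_char"
  shows "jacobi [a, b] = - (\<Sum>u\<in>- {0}. mchar a u * mchar b (1 - u))"
proof -
  have add_eq_1: "x + y = 1 \<longleftrightarrow> y = 1 - x" for x y :: 'a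
    by (auto simp: algebra_simps)
  have "(\<Sum>xs | length xs = 2 \<and> set xs \<subseteq> - {0} \<and> sum_list xs = 1. \<Prod>i<2. mchar ([a, b] ! i) (xs ! i))
      = (\<Sum>u\<in>- {0, 1}. mchar a u * mchar b (1 - u))"
    by (rule sum.reindex_bij_witness[of _ "\<lambda>u. [u, 1 - u]" hd])
      (auto simp: length_Suc_conv numeral_2_eq_2 lessThan_Suc add_eq_1)
  also have "\<dots> = (\<Sum>u\<in>- {0}. mchar a u * mchar b (1 - u))"
    by (rule sum.mono_neutral_left) auto
  finally show ?thesis by (simp add: jacobi_def numeral_2_eq_2)
qed

section \<open>Integral representations\<close>

theorem theorem3p1:
  fixes \<psi> :: "'a :: {field, finite} \<Rightarrow> complex"
    and n :: nat
    and \<alpha> \<gamma> :: "'a mult_char"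
    and \<beta> :: "nat \<Rightarrow> 'a mult_char"
  assumes "nontrivial_additive_char \<psi>"
    and "n \<ge> 1"
  shows "(\<alpha> \<noteq> \<gamma> \<and> (\<forall>i\<in>{1..n}. \<beta> i \<noteq> 1) \<longrightarrow>
      (\<forall>l :: nat \<Rightarrow> 'a. (\<forall>i\<in>{1..n}. l i \<noteq> 0) \<longrightarrow>
        - jacobi [\<alpha>, inverse \<alpha> * \<gamma>] * lauricella_FD \<psi> n \<alpha> \<beta> \<gamma> l =
        (\<Sum>u\<in>- {0}. (\<Prod>i=1..n. mchar (inverse (\<beta> i)) (1 - l i * u)) *
           mchar \<alpha> u * mchar (inverse \<alpha> * \<gamma>) (1 - u))))
    \<and> (\<alpha> \<noteq> 1 \<and> (\<Prod>i=1..n. \<beta> i) \<noteq> \<gamma> \<longrightarrow>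
      (\<forall>l :: nat \<Rightarrow> 'a. (\<forall>i\<in>{1..n}. l i \<noteq> 0) \<longrightarrow>
        (- 1) ^ n *
        ((\<Prod>i=1..n. gauss \<psi> (\<beta> i)) * gauss \<psi> (inverse (\<Prod>i=1..n. \<beta> i) * \<gamma>) / gauss_circ \<psi> \<gamma>) *
        lauricella_FD \<psi> n \<alpha> \<beta> \<gamma> l =
        (\<Sum>u\<in>{1..n} \<rightarrow>\<^sub>E - {0}. mchar (inverse \<alpha>) (1 - (\<Sum>i=1..n. l i * u i)) *
           (\<Prod>i=1..n. mchar (\<beta> i) (u i)) *
           mchar (inverse (\<Prod>i=1..n. \<beta> i) * \<gamma>) (1 - (\<Sum>i=1..n. u i)))))"
proof (intro conjI impI allI; elim conjE)
  let ?q = "of_nat CARD('a) :: complex"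
  note psi = assms(1)
  fix l :: "nat \<Rightarrow> 'a"
  assume l: "\<forall>i\<in>{1..n}. l i \<noteq> 0"
  {
    assume \<alpha>\<gamma>: "\<alpha> \<noteq> \<gamma>" and \<beta>: "\<forall>i\<in>{1..n}. \<beta> i \<noteq> 1"
    define b where "b = inverse \<alpha> * \<gamma>"
    have b: "b \<noteq> 1" using \<alpha>\<gamma> by (simp add: b_def inverse_mult_char_mult_eq_1_iff)
    have \<alpha>b: "\<alpha> * b = \<gamma>" by (simp add: b_def)
    \<comment> \<open>The Gauss sums in the Jacobi sum cancel the denominators of the Pochhammer symbols.\<close>
    have ratio: "- jacobi [\<alpha>, b] * (poch \<psi> \<alpha> N / poch_circ \<psi> \<gamma> N)
        = (\<Sum>u\<in>- {0}. mchar \<alpha> u * mchar N u * mchar b (1 - u))" for N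
    proof -
      have "\<alpha> * N * b = \<gamma> * N" by (metis \<alpha>b mult.assoc mult.commute)
      then show ?thesis
        using beta_integral[OF psi b, of \<alpha>] beta_integral[OF psi b, of "\<alpha> * N"] \<alpha>b psi
        by (simp add: jacobi_two poch_def poch_circ_def mchar_times)
    qed
    have "- jacobi [\<alpha>, b] * lauricella_FD \<psi> n \<alpha> \<beta> \<gamma> l = 1 / (1 - ?q) ^ n *
      (\<Sum>\<nu>\<in>{1..n} \<rightarrow>\<^sub>E UNIV. (- jacobi [\<alpha>, b] * (poch \<psi> \<alpha> (\<Prod>i=1..n. \<nu> i) / poch_circ \<psi> \<gamma> (\<Prod>i=1..n. \<nu> i))) *
        (\<Prod>i=1..n. poch \<psi> (\<beta> i) (\<nu> i) / poch_circ \<psi> 1 (\<nu> i) * mchar (\<nu> i) (l i)))"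
      unfolding lauricella_FD_def by (simp add: sum_distrib_left prod.distrib prod_dividef mult_ac)
    also have "\<dots> = 1 / (1 - ?q) ^ n * (\<Sum>u\<in>- {0}. mchar \<alpha> u * mchar b (1 - u) * (\<Sum>\<nu>\<in>{1..n} \<rightarrow>\<^sub>E UNIV.
        (\<Prod>i=1..n. poch \<psi> (\<beta> i) (\<nu> i) / poch_circ \<psi> 1 (\<nu> i) * mchar (\<nu> i) (l i * u))))"
      unfolding ratio sum_distrib_right sum_distrib_left
      by (subst sum.swap, intro sum.cong refl)
        (simp add: mchar_prod mchar_mult prod.distrib prod_dividef mult_ac)
    also have "\<dots> = 1 / (1 - ?q) ^ n * (\<Sum>u\<in>- {0}. mchar \<alpha> u * mchar b (1 - u) *
        (\<Prod>i=1..n. (1 - ?q) * mchar (inverse (\<beta> i)) (1 - l i * u)))"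
    proof (intro arg_cong[of _ _ "(*) _"] sum.cong refl)
      fix u :: 'a assume "u \<in> - {0}"
      then show "(\<Sum>\<nu>\<in>{1..n} \<rightarrow>\<^sub>E UNIV.
        (\<Prod>i=1..n. poch \<psi> (\<beta> i) (\<nu> i) / poch_circ \<psi> 1 (\<nu> i) * mchar (\<nu> i) (l i * u)))
        = (\<Prod>i=1..n. (1 - ?q) * mchar (inverse (\<beta> i)) (1 - l i * u))"
        using l \<beta>
        by (subst prod_sum_PiE[symmetric]) (auto intro!: prod.cong univariate_binomial[OF psi]
            simp del: times_divide_eq_left)
    qed
    also have "\<dots> = (\<Sum>u\<in>- {0}. (\<Prod>i=1..n. mchar (inverse (\<beta> i)) (1 - l i * u)) *
           mchar \<alpha> u * mchar b (1 - u))"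
      by (simp add: prod.distrib sum_distrib_left mult_ac)
    finally show "- jacobi [\<alpha>, inverse \<alpha> * \<gamma>] * lauricella_FD \<psi> n \<alpha> \<beta> \<gamma> l =
        (\<Sum>u\<in>- {0}. (\<Prod>i=1..n. mchar (inverse (\<beta> i)) (1 - l i * u)) *
           mchar \<alpha> u * mchar (inverse \<alpha> * \<gamma>) (1 - u))"
      by (simp only: b_def)
  next
    assume \<alpha>: "\<alpha> \<noteq> 1" and B\<gamma>: "(\<Prod>i=1..n. \<beta> i) \<noteq> \<gamma>"
    define B where "B = (\<Prod>i=1..n. \<beta> i)"
    define c where "c = inverse B * \<gamma>"
    have c: "c \<noteq> 1" using B\<gamma> by (auto simp: c_def B_def inverse_mult_char_mult_eq_1_iff)
    have Bc: "B * c = \<gamma>" by (simp add: c_def)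
    define C where "C = (- 1) ^ n * ((\<Prod>i=1..n. gauss \<psi> (\<beta> i)) * gauss \<psi> c / gauss_circ \<psi> \<gamma>)"
    \<comment> \<open>The Gauss sums in \<open>C\<close> cancel the denominators of the Pochhammer symbols.\<close>
    have ratio: "C * ((\<Prod>i=1..n. poch \<psi> (\<beta> i) (\<nu> i)) / poch_circ \<psi> \<gamma> (\<Prod>i=1..n. \<nu> i))
        = (\<Sum>u\<in>{1..n} \<rightarrow>\<^sub>E - {0}. (\<Prod>i=1..n. mchar (\<beta> i) (u i)) * (\<Prod>i=1..n. mchar (\<nu> i) (u i)) *
            mchar c (1 - (\<Sum>i=1..n. u i)))" for \<nu>
    proof -
      have "(\<Prod>i=1..n. \<beta> i * \<nu> i) * c = \<gamma> * (\<Prod>i=1..n. \<nu> i)"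
        unfolding prod.distrib B_def[symmetric] by (metis Bc mult.assoc mult.commute)
      then show ?thesis
        using dirichlet_integral[OF psi _ c, of "{1..n}" "\<lambda>i. \<beta> i * \<nu> i"] psi
        by (simp add: C_def poch_def poch_circ_def mchar_times prod.distrib prod_dividef)
    qed
    have "C * lauricella_FD \<psi> n \<alpha> \<beta> \<gamma> l = 1 / (1 - ?q) ^ n *
      (\<Sum>\<nu>\<in>{1..n} \<rightarrow>\<^sub>E UNIV. (C * ((\<Prod>i=1..n. poch \<psi> (\<beta> i) (\<nu> i)) / poch_circ \<psi> \<gamma> (\<Prod>i=1..n. \<nu> i))) *
        (poch \<psi> \<alpha> (\<Prod>i=1..n. \<nu> i) / (\<Prod>i=1..n. poch_circ \<psi> 1 (\<nu> i)) * (\<Prod>i=1..n. mchar (\<nu> i) (l i))))"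
      unfolding lauricella_FD_def by (simp add: sum_distrib_left mult_ac)
    also have "\<dots> = 1 / (1 - ?q) ^ n * (\<Sum>u\<in>{1..n} \<rightarrow>\<^sub>E - {0}. (\<Prod>i=1..n. mchar (\<beta> i) (u i)) *
        mchar c (1 - (\<Sum>i=1..n. u i)) * (\<Sum>\<nu>\<in>{1..n} \<rightarrow>\<^sub>E UNIV.
        poch \<psi> \<alpha> (\<Prod>i=1..n. \<nu> i) / (\<Prod>i=1..n. poch_circ \<psi> 1 (\<nu> i)) *
        (\<Prod>i=1..n. mchar (\<nu> i) (l i * u i))))"
      unfolding ratio sum_distrib_right sum_distrib_left
      by (subst sum.swap, intro sum.cong refl) (simp add: mchar_mult prod.distrib mult_ac)
    also have "\<dots> = 1 / (1 - ?q) ^ n * (\<Sum>u\<in>{1..n} \<rightarrow>\<^sub>E - {0}. (\<Prod>i=1..n. mchar (\<beta> i) (u i)) *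
        mchar c (1 - (\<Sum>i=1..n. u i)) *
        ((1 - ?q) ^ n * mchar (inverse \<alpha>) (1 - (\<Sum>i=1..n. l i * u i))))"
    proof (intro arg_cong[of _ _ "(*) _"] sum.cong refl)
      fix u :: "nat \<Rightarrow> 'a" assume u: "u \<in> {1..n} \<rightarrow>\<^sub>E - {0}"
      have "l i * u i \<noteq> 0" if "i \<in> {1..n}" for i
        using PiE_mem[OF u that] l that by auto
      then show "(\<Sum>\<nu>\<in>{1..n} \<rightarrow>\<^sub>E UNIV.
          poch \<psi> \<alpha> (\<Prod>i=1..n. \<nu> i) / (\<Prod>i=1..n. poch_circ \<psi> 1 (\<nu> i)) *
          (\<Prod>i=1..n. mchar (\<nu> i) (l i * u i)))
        = (1 - ?q) ^ n * mchar (inverse \<alpha>) (1 - (\<Sum>i=1..n. l i * u i))"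
        using multivariate_binomial[OF psi _ \<alpha>, of "{1..n}" "\<lambda>i. l i * u i"] by simp
    qed
    also have "\<dots> = (\<Sum>u\<in>{1..n} \<rightarrow>\<^sub>E - {0}. mchar (inverse \<alpha>) (1 - (\<Sum>i=1..n. l i * u i)) *
           (\<Prod>i=1..n. mchar (\<beta> i) (u i)) * mchar c (1 - (\<Sum>i=1..n. u i)))"
      by (simp add: sum_distrib_left mult_ac)
    finally show "(- 1) ^ n *
        ((\<Prod>i=1..n. gauss \<psi> (\<beta> i)) * gauss \<psi> (inverse (\<Prod>i=1..n. \<beta> i) * \<gamma>) / gauss_circ \<psi> \<gamma>) *
        lauricella_FD \<psi> n \<alpha> \<beta> \<gamma> l =
        (\<Sum>u\<in>{1..n} \<rightarrow>\<^sub>E - {0}. mchar (inverse \<alpha>) (1 - (\<Sum>i=1..n. l i * u i)) *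
           (\<Prod>i=1..n. mchar (\<beta> i) (u i)) *
           mchar (inverse (\<Prod>i=1..n. \<beta> i) * \<gamma>) (1 - (\<Sum>i=1..n. u i)))"
      by (simp only: C_def c_def B_def)
  }
qed

end
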